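(* Let $n\geq 3$ and let $p$ and $l$ be integers such that $p\geq 4$ and $l\geq 2$. Let $P_1,\ldots,P_p$ be points and $\Lambda_1,\ldots,\Lambda_l$ codimension two linear subspaces in generic position in $\mathbb{P}^n$. Then there exists no rational normal curve in $\mathbb{P}^n$ passing through $P_1,\ldots,P_p$ and $(n-1)$-secant to each of $\Lambda_1,\ldots,\Lambda_l$.
   Context: The base field is $\mathbb{C}$. A rational normal curve in $\mathbb{P}^n$ is an irreducible, reduced, smooth, rational, linearly normal curve $\mathcal{C}\subset\mathbb{P}^n$ of degree $n$ (spanning $\mathbb{P}^n$), i.e. a linearly normal embedding of $\mathbb{P}^1$ by the complete linear series of degree $n$. A codimension two linear space $\Lambda\subset\mathbb{P}^n$ and a rational normal curve $\mathcal{C}$ are said to be $(n-1)$-secant to each other if $\Lambda\cap\mathcal{C}$ is a set of $n-1$ distinct points. "In generic position" means: there is a non-empty Zariski open subset $U$ of the data space $\mathcal{D}=G(n-2,\mathbb{P}^n)^l\times(\mathbb{P}^n)^p$, where $G(n-2,\mathbb{P}^n)$ is the Grassmannian of codimension two linear subspaces of $\mathbb{P}^n$, such that the conclusion holds for all $(\Lambda_1,\ldots,\Lambda_l,P_1,\ldots,P_p)\in U$. *)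

theory Defs
  imports "HOL-Analysis.Analysis"
begin

text \<open>
  Projective space of dimension \<open>n\<close> is the space of lines through the origin of \<open>complex ^ 'n\<close> where
  \<open>CARD('n) = n + 1\<close>. A \<open>k\<close>-dimensional linear subspace of it is a complex linear subspace of
  \<open>complex ^ 'n\<close> of vector space dimension \<open>k + 1\<close>; in particular points are the elements of
  \<open>proj_subspaces 0\<close>, and a point \<open>P\<close> lies on \<open>\<Lambda>\<close> iff \<open>P \<subseteq> \<Lambda>\<close>. (The constants \<open>vec.subspace\<close>,
  \<open>vec.dim\<close>, \<open>vec.span\<close> are the linear-algebra notions over the field of scalars, here the
  complex numbers.)
\<close>

definition proj_subspaces :: "nat \<Rightarrow> (complex ^ 'n) set set" where
  "proj_subspaces k = {W. vec.subspace W \<and> vec.dim W = k + 1}"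

definition proj_points :: "(complex ^ 'n) set set" where
  "proj_points = proj_subspaces 0"

text \<open>Binary forms of degree \<open>n\<close>, i.e. the global sections of \<open>O(n)\<close> on the projective line.
  As the field is infinite, forms may be identified with the functions they define.\<close>

definition binary_forms :: "nat \<Rightarrow> (complex \<Rightarrow> complex \<Rightarrow> complex) set" where
  "binary_forms n = {g. \<exists>c :: nat \<Rightarrow> complex. g = (\<lambda>s t. \<Sum>k\<le>n. c k * s ^ k * t ^ (n - k))}"

text \<open>A rational normal curve is the image of the projective line under the map given by the complete
  linear series of degree \<open>n\<close>: \<open>[s : t]\<close> is sent to the point with homogeneous coordinates
  \<open>f\<^sub>i(s, t)\<close>, where the \<open>f\<^sub>i\<close> form a basis of the space of all binary forms of degree \<open>n\<close>.
  The second conjunct is the basis property.\<close>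

definition rational_normal_curve :: "nat \<Rightarrow> (complex ^ 'n) set set \<Rightarrow> bool" where
  "rational_normal_curve n C \<longleftrightarrow>
    (\<exists>f :: 'n \<Rightarrow> complex \<Rightarrow> complex \<Rightarrow> complex.
       (\<forall>i. f i \<in> binary_forms n) \<and>
       (\<forall>g \<in> binary_forms n. \<exists>!c :: complex ^ 'n. g = (\<lambda>s t. \<Sum>i\<in>UNIV. c $ i * f i s t)) \<and>
       C = {vec.span {\<chi> i. f i s t} | s t. (s, t) \<noteq> (0, 0)})"

definition secant :: "nat \<Rightarrow> (complex ^ 'n) set \<Rightarrow> (complex ^ 'n) set set \<Rightarrow> bool" where
  "secant m \<Lambda> C \<longleftrightarrow> finite {P \<in> C. P \<subseteq> \<Lambda>} \<and> card {P \<in> C. P \<subseteq> \<Lambda>} = m"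

definition data_space ::
  "nat \<Rightarrow> nat \<Rightarrow> nat \<Rightarrow> ((nat \<Rightarrow> (complex ^ 'n) set) \<times> (nat \<Rightarrow> (complex ^ 'n) set)) set" where
  "data_space n l p = ({..<l} \<rightarrow>\<^sub>E proj_subspaces (n - 2)) \<times> ({..<p} \<rightarrow>\<^sub>E proj_points)"

text \<open>The Zariski topology on the data space: it is embedded in a product of projective spaces
  by the Pluecker coordinates of the \<open>\<Lambda>\<^sub>i\<close> and the homogeneous coordinates of the \<open>P\<^sub>j\<close>, and closed
  sets are the common zero loci of multihomogeneous polynomials in these coordinates. For a
  codimension two subspace with equations \<open>a = b = 0\<close> we use the dual Pluecker coordinates,
  the \<open>2 \<times> 2\<close> minors of the pair of equations \<open>(a, b)\<close>; up to order and sign they agree with the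
  maximal minors of a spanning family, up to a common scalar.\<close>

definition pluecker :: "complex ^ 'n \<Rightarrow> complex ^ 'n \<Rightarrow> 'n \<Rightarrow> 'n \<Rightarrow> complex" where
  "pluecker a b = (\<lambda>i j. a $ i * b $ j - a $ j * b $ i)"

definition linear_locus :: "complex ^ 'n \<Rightarrow> complex ^ 'n \<Rightarrow> (complex ^ 'n) set" where
  "linear_locus a b = {x. (\<Sum>i\<in>UNIV. a $ i * x $ i) = 0 \<and> (\<Sum>i\<in>UNIV. b $ i * x $ i) = 0}"

text \<open>Polynomials in the Pluecker coordinates \<open>q i a b\<close> of the \<open>i\<close>-th subspace (\<open>i < l\<close>) and the
  coordinates \<open>x j $ a\<close> of the \<open>j\<close>-th point (\<open>j < p\<close>), as functions.\<close>

inductive polynomial_fun ::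
  "nat \<Rightarrow> nat \<Rightarrow> ((nat \<Rightarrow> 'n \<Rightarrow> 'n \<Rightarrow> complex) \<Rightarrow> (nat \<Rightarrow> complex ^ 'n) \<Rightarrow> complex) \<Rightarrow> bool"
  for l p where
  const: "polynomial_fun l p (\<lambda>q x. c)"
| subspace_coord: "i < l \<Longrightarrow> polynomial_fun l p (\<lambda>q x. q i a b)"
| point_coord: "j < p \<Longrightarrow> polynomial_fun l p (\<lambda>q x. x j $ a)"
| add: "polynomial_fun l p f \<Longrightarrow> polynomial_fun l p g \<Longrightarrow> polynomial_fun l p (\<lambda>q x. f q x + g q x)"
| mult: "polynomial_fun l p f \<Longrightarrow> polynomial_fun l p g \<Longrightarrow> polynomial_fun l p (\<lambda>q x. f q x * g q x)"

definition multihomogeneous ::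
  "nat \<Rightarrow> nat \<Rightarrow> ((nat \<Rightarrow> 'n \<Rightarrow> 'n \<Rightarrow> complex) \<Rightarrow> (nat \<Rightarrow> complex ^ 'n) \<Rightarrow> complex) \<Rightarrow> bool" where
  "multihomogeneous l p f \<longleftrightarrow>
    (\<exists>d e :: nat \<Rightarrow> nat. \<forall>s t :: nat \<Rightarrow> complex. \<forall>q x.
       f (\<lambda>i a b. s i * q i a b) (\<lambda>j. t j *s x j) =
         (\<Prod>i<l. s i ^ d i) * (\<Prod>j<p. t j ^ e j) * f q x)"

text \<open>For multihomogeneous \<open>f\<close> the vanishing below does not depend on the choice of equations
  \<open>a i, b i\<close> and of homogeneous coordinates \<open>v j\<close>.\<close>

definition vanishes_at ::
  "nat \<Rightarrow> nat \<Rightarrow> ((nat \<Rightarrow> 'n \<Rightarrow> 'n \<Rightarrow> complex) \<Rightarrow> (nat \<Rightarrow> complex ^ 'n) \<Rightarrow> complex) \<Rightarrow>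
    (nat \<Rightarrow> (complex ^ 'n) set) \<Rightarrow> (nat \<Rightarrow> (complex ^ 'n) set) \<Rightarrow> bool" where
  "vanishes_at l p f \<Lambda> P \<longleftrightarrow>
    (\<forall>a b v. (\<forall>i<l. \<Lambda> i = linear_locus (a i) (b i)) \<and> (\<forall>j<p. P j = vec.span {v j}) \<longrightarrow>
       f (\<lambda>i. pluecker (a i) (b i)) v = 0)"

definition zariski_closed ::
  "nat \<Rightarrow> nat \<Rightarrow> nat \<Rightarrow>
    ((nat \<Rightarrow> (complex ^ 'n) set) \<times> (nat \<Rightarrow> (complex ^ 'n) set)) set \<Rightarrow> bool" where
  "zariski_closed n l p Z \<longleftrightarrow>
    (\<exists>F. (\<forall>f\<in>F. polynomial_fun l p f \<and> multihomogeneous l p f) \<and>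
         Z = {(\<Lambda>, P) \<in> data_space n l p. \<forall>f\<in>F. vanishes_at l p f \<Lambda> P})"

definition zariski_open ::
  "nat \<Rightarrow> nat \<Rightarrow> nat \<Rightarrow>
    ((nat \<Rightarrow> (complex ^ 'n) set) \<times> (nat \<Rightarrow> (complex ^ 'n) set)) set \<Rightarrow> bool" where
  "zariski_open n l p U \<longleftrightarrow> U \<subseteq> data_space n l p \<and> zariski_closed n l p (data_space n l p - U)"

end

theory Submission
  imports Defs
begin

text \<open>
  Let \<open>\<Lambda>\<^sub>0 = {a = b = 0}\<close> be one of the given subspaces and let \<open>\<phi>(z)\<close>, for \<open>z\<close> on the projective
  line, parametrize a rational normal curve that is \<open>(n - 1)\<close>-secant to it. Pulled back along
  \<open>\<phi>\<close>, the linear forms \<open>a\<close> and \<open>b\<close> become binary forms of degree \<open>n\<close> with \<open>n - 1\<close> common roots, so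
  they are products \<open>g L\<close> and \<open>g M\<close> with a common factor \<open>g\<close> and with \<open>L\<close>, \<open>M\<close> linear. In other words,
  projection from \<open>\<Lambda>\<^sub>0\<close>, the rational map \<open>x \<mapsto> [a(x) : b(x)]\<close>, restricts to an isomorphism of the
  curve with the projective line. The same holds for the second subspace \<open>\<Lambda>\<^sub>1\<close>. Hence four points of the curve have the same cross-ratio
  after projection from \<open>\<Lambda>\<^sub>0\<close> as after projection from \<open>\<Lambda>\<^sub>1\<close>, namely the cross-ratio of their
  parameters. (Equivalently: the four products of an equation of \<open>\<Lambda>\<^sub>0\<close> with an equation of \<open>\<Lambda>\<^sub>1\<close>
  restrict to a space of dimension at most three on the curve, so that some quadric containing
  both subspaces contains the curve; and four general points lie on no such quadric.)

  Equality of the two cross-ratios of \<open>P\<^sub>0, \<dots>, P\<^sub>3\<close>, with denominators cleared, is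
  the vanishing of one multihomogeneous polynomial, \<open>cross_ratio_difference\<close>, in the Pluecker
  coordinates of the two subspaces and the coordinates of the four points: a cross-ratio is
  made of \<open>2 \<times> 2\<close> determinants \<open>a(x) b(y) - a(y) b(x)\<close>, which depend on \<open>a, b\<close> only through their
  Pluecker coordinates (\<open>bracket_pluecker\<close>). The open set is its
  non-vanishing locus. Lemma \<open>cross_ratio_difference_on_curve\<close> shows that
  no curve exists over it, and a configuration made of coordinate subspaces and sums of
  coordinate vectors shows that it is not empty.
\<close>

section \<open>Division of binary forms by linear factors\<close>

lemma binary_formsI: "g = (\<lambda>s t. \<Sum>k\<le>n. c k * s ^ k * t ^ (n - k)) \<Longrightarrow> g \<in> binary_forms n"
  unfolding binary_forms_def by (rule CollectI) (rule exI)

lemma binary_formsE: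
  assumes "g \<in> binary_forms n"
  obtains c where "g = (\<lambda>s t. \<Sum>k\<le>n. c k * s ^ k * t ^ (n - k))"
  using assms unfolding binary_forms_def by (elim CollectE exE)

lemma binary_forms_add:
  assumes "g \<in> binary_forms n" "h \<in> binary_forms n"
  shows "(\<lambda>s t. g s t + h s t) \<in> binary_forms n"
proof -
  obtain c where c: "g = (\<lambda>s t. \<Sum>k\<le>n. c k * s ^ k * t ^ (n - k))"
    by (rule binary_formsE[OF assms(1)])
  obtain d where d: "h = (\<lambda>s t. \<Sum>k\<le>n. d k * s ^ k * t ^ (n - k))"
    by (rule binary_formsE[OF assms(2)])
  show ?thesis
    by (rule binary_formsI[where c = "\<lambda>k. c k + d k"]) (simp add: c d sum.distrib algebra_simps)
qed

lemma binary_forms_scale: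
  assumes "g \<in> binary_forms n"
  shows "(\<lambda>s t. r * g s t) \<in> binary_forms n"
proof -
  obtain c where c: "g = (\<lambda>s t. \<Sum>k\<le>n. c k * s ^ k * t ^ (n - k))"
    by (rule binary_formsE[OF assms])
  show ?thesis
    by (rule binary_formsI[where c = "\<lambda>k. r * c k"]) (simp add: c sum_distrib_left algebra_simps)
qed

lemma binary_forms_sum:
  assumes "finite I" "\<And>i. i \<in> I \<Longrightarrow> g i \<in> binary_forms n"
  shows "(\<lambda>s t. \<Sum>i\<in>I. g i s t) \<in> binary_forms n"
  using assms
proof (induction I rule: finite_induct)
  case empty
  show ?case by (rule binary_formsI[where c = "\<lambda>_. 0"]) simp
next
  case (insert i I)
  then show ?case using binary_forms_add[of "g i" n "\<lambda>s t. \<Sum>i\<in>I. g i s t"] by simp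
qed

lemma binary_forms_times_fst:
  assumes "g \<in> binary_forms n"
  shows "(\<lambda>s t. s * g s t) \<in> binary_forms (Suc n)"
proof -
  obtain c where c: "g = (\<lambda>s t. \<Sum>k\<le>n. c k * s ^ k * t ^ (n - k))"
    by (rule binary_formsE[OF assms])
  show ?thesis
    by (rule binary_formsI[where c = "\<lambda>k. case k of 0 \<Rightarrow> 0 | Suc j \<Rightarrow> c j"])
      (simp add: c sum.atMost_Suc_shift sum_distrib_left algebra_simps del: sum.atMost_Suc)
qed

lemma binary_forms_power_snd: "(\<lambda>s t. c * t ^ n) \<in> binary_forms n"
  by (rule binary_formsI[where c = "\<lambda>k. if k = 0 then c else 0"])
    (simp add: if_distrib[of "\<lambda>x. x * _"] sum.delta cong: if_cong)

lemma binary_forms_SucE: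
  assumes "g \<in> binary_forms (Suc n)"
  obtains c h where "h \<in> binary_forms n" "g = (\<lambda>s t. c * t ^ Suc n + s * h s t)"
proof -
  obtain d where d: "g = (\<lambda>s t. \<Sum>k\<le>Suc n. d k * s ^ k * t ^ (Suc n - k))"
    by (rule binary_formsE[OF assms])
  show thesis
  proof
    show "(\<lambda>s t. \<Sum>k\<le>n. d (Suc k) * s ^ k * t ^ (n - k)) \<in> binary_forms n"
      by (rule binary_formsI[OF refl])
    show "g = (\<lambda>s t. d 0 * t ^ Suc n + s * (\<Sum>k\<le>n. d (Suc k) * s ^ k * t ^ (n - k)))"
      by (simp add: d sum.atMost_Suc_shift sum_distrib_left algebra_simps del: sum.atMost_Suc)
  qed
qed

lemma binary_form_homogeneous:
  assumes "g \<in> binary_forms n"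
  shows "g (r * s) (r * t) = r ^ n * g s t"
proof -
  obtain c where c: "g = (\<lambda>s t. \<Sum>k\<le>n. c k * s ^ k * t ^ (n - k))"
    by (rule binary_formsE[OF assms])
  have "c k * (r * s) ^ k * (r * t) ^ (n - k) = r ^ n * (c k * s ^ k * t ^ (n - k))"
    if "k \<le> n" for k
  proof -
    have "r ^ n = r ^ k * r ^ (n - k)" using that by (simp flip: power_add)
    then show ?thesis by (simp add: power_mult_distrib)
  qed
  then show ?thesis
    unfolding c sum_distrib_left by (intro sum.cong) auto
qed

text \<open>Homogeneous synthetic division: modulo \<open>t\<^sub>0 s - s\<^sub>0 t\<close> one may replace \<open>t\<^sub>0 s\<close> by \<open>s\<^sub>0 t\<close>, so
  \<open>t\<^sub>0\<^sup>n\<^sup>+\<^sup>1 g(s, t) = g(t\<^sub>0 s, t\<^sub>0 t)\<close> becomes \<open>g(s\<^sub>0 t, t\<^sub>0 t) = t\<^sup>n\<^sup>+\<^sup>1 g(s\<^sub>0, t\<^sub>0)\<close>. The induction performs the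
  replacement one factor \<open>s\<close> at a time.\<close>

lemma binary_form_division:
  assumes "g \<in> binary_forms (Suc n)"
  shows "\<exists>h \<in> binary_forms n. \<forall>s t.
    t\<^sub>0 ^ Suc n * g s t = (t\<^sub>0 * s - s\<^sub>0 * t) * h s t + t ^ Suc n * g s\<^sub>0 t\<^sub>0"
  using assms
proof (induction n arbitrary: g)
  case 0
  obtain c h where h: "h \<in> binary_forms 0" "g = (\<lambda>s t. c * t ^ Suc 0 + s * h s t)"
    using binary_forms_SucE[OF 0] by blast
  obtain d where d: "h = (\<lambda>s t. \<Sum>k\<le>0. d k * s ^ k * t ^ (0 - k))"
    by (rule binary_formsE[OF h(1)])
  show ?case
    by (rule bexI[OF _ h(1)]) (simp add: h(2) d algebra_simps)
next
  case (Suc n)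
  obtain c g1 where g1: "g1 \<in> binary_forms (Suc n)"
    and g: "g = (\<lambda>s t. c * t ^ Suc (Suc n) + s * g1 s t)"
    using binary_forms_SucE[OF Suc.prems] by blast
  obtain h1 where h1: "h1 \<in> binary_forms n"
    and eq: "\<And>s t. t\<^sub>0 ^ Suc n * g1 s t = (t\<^sub>0 * s - s\<^sub>0 * t) * h1 s t + t ^ Suc n * g1 s\<^sub>0 t\<^sub>0"
    using Suc.IH[OF g1] by blast
  let ?h = "\<lambda>s t. t\<^sub>0 * (s * h1 s t) + g1 s\<^sub>0 t\<^sub>0 * t ^ Suc n"
  have "?h \<in> binary_forms (Suc n)"
    by (rule binary_forms_add[OF binary_forms_scale[OF binary_forms_times_fst[OF h1]]
          binary_forms_power_snd])
  moreover have "t\<^sub>0 ^ Suc (Suc n) * g s t =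
      (t\<^sub>0 * s - s\<^sub>0 * t) * ?h s t + t ^ Suc (Suc n) * g s\<^sub>0 t\<^sub>0" for s t
  proof -
    have "t\<^sub>0 ^ Suc (Suc n) * g s t =
        c * t ^ Suc (Suc n) * t\<^sub>0 ^ Suc (Suc n) + t\<^sub>0 * s * (t\<^sub>0 ^ Suc n * g1 s t)"
      by (simp add: g algebra_simps)
    also have "\<dots> = (t\<^sub>0 * s - s\<^sub>0 * t) * ?h s t + t ^ Suc (Suc n) * g s\<^sub>0 t\<^sub>0"
      unfolding eq by (simp add: g algebra_simps)
    finally show ?thesis .
  qed
  ultimately show ?case by (intro bexI[of _ ?h]) auto
qed

lemma binary_form_factor:
  assumes g: "g \<in> binary_forms (Suc n)" and z: "g s\<^sub>0 t\<^sub>0 = 0" and nz: "(s\<^sub>0, t\<^sub>0) \<noteq> (0, 0)"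
  obtains h where "h \<in> binary_forms n" "\<And>s t. g s t = (t\<^sub>0 * s - s\<^sub>0 * t) * h s t"
proof (cases "t\<^sub>0 = 0")
  case False
  obtain h where h: "h \<in> binary_forms n"
    and eq: "\<And>s t. t\<^sub>0 ^ Suc n * g s t = (t\<^sub>0 * s - s\<^sub>0 * t) * h s t"
    using binary_form_division[OF g, of t\<^sub>0 s\<^sub>0] z by auto
  show thesis
  proof
    show "(\<lambda>s t. inverse (t\<^sub>0 ^ Suc n) * h s t) \<in> binary_forms n"
      by (rule binary_forms_scale[OF h])
    show "g s t = (t\<^sub>0 * s - s\<^sub>0 * t) * (inverse (t\<^sub>0 ^ Suc n) * h s t)" for s t
      using eq[of s t] False by (simp add: field_simps)
  qed
next
  \<comment> \<open>At the point \<open>[1 : 0]\<close> the division identity says nothing; there a root means that the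
    coefficient of the highest power of \<open>s\<close> vanishes, which leaves a factor \<open>t\<close>.\<close>
  case True
  with nz have s0: "s\<^sub>0 \<noteq> 0" by simp
  obtain c where c: "g = (\<lambda>s t. \<Sum>k\<le>Suc n. c k * s ^ k * t ^ (Suc n - k))"
    by (rule binary_formsE[OF g])
  have "(\<Sum>k\<le>n. c k * s\<^sub>0 ^ k * 0 ^ (Suc n - k)) = 0"
    by (rule sum.neutral) auto
  then have top: "c (Suc n) = 0"
    using z s0 True by (simp add: c)
  have eq: "g s t = t * (\<Sum>k\<le>n. c k * s ^ k * t ^ (n - k))" for s t
    by (simp add: c top sum_distrib_left Suc_diff_le algebra_simps)
  show thesis
  proof
    show "(\<lambda>s t. - inverse s\<^sub>0 * (\<Sum>k\<le>n. c k * s ^ k * t ^ (n - k))) \<in> binary_forms n"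
      by (rule binary_forms_scale[OF binary_formsI[OF refl]])
    show "g s t = (t\<^sub>0 * s - s\<^sub>0 * t) * (- inverse s\<^sub>0 * (\<Sum>k\<le>n. c k * s ^ k * t ^ (n - k)))"
      for s t
      using s0 True by (simp add: eq)
  qed
qed

text \<open>\<open>Z\<close> represents distinct points of the projective line by pairwise non-proportional coordinate
  pairs. Each linear factor vanishes at no other point of \<open>Z\<close>, so the remaining roots
  pass to the quotient. The product that is split off depends on \<open>Z\<close> alone, so it is
  common to all forms vanishing on \<open>Z\<close>.\<close>

lemma binary_form_factor_set:
  assumes "finite Z" and "(0, 0) \<notin> Z"
    and "\<And>s t s' t'. (s, t) \<in> Z \<Longrightarrow> (s', t') \<in> Z \<Longrightarrow> t' * s = s' * t \<Longrightarrow> (s, t) = (s', t')"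
    and "g \<in> binary_forms (card Z + m)" and "\<And>s t. (s, t) \<in> Z \<Longrightarrow> g s t = 0"
  shows "\<exists>h \<in> binary_forms m. \<forall>s t. g s t = (\<Prod>z\<in>Z. snd z * s - fst z * t) * h s t"
  using assms
proof (induction Z arbitrary: g rule: finite_induct)
  case empty
  then show ?case by auto
next
  case (insert z Z)
  obtain s\<^sub>0 t\<^sub>0 where z: "z = (s\<^sub>0, t\<^sub>0)" by force
  have "g \<in> binary_forms (Suc (card Z + m))" using insert.prems(3) insert.hyps by simp
  moreover have "g s\<^sub>0 t\<^sub>0 = 0" "(s\<^sub>0, t\<^sub>0) \<noteq> (0, 0)"
    using insert.prems(1) insert.prems(4)[of s\<^sub>0 t\<^sub>0] by (auto simp: z)
  ultimately obtain g1 where g1: "g1 \<in> binary_forms (card Z + m)"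
    and eq: "\<And>s t. g s t = (t\<^sub>0 * s - s\<^sub>0 * t) * g1 s t"
    by (rule binary_form_factor) (rule that)
  have "\<exists>h \<in> binary_forms m. \<forall>s t. g1 s t = (\<Prod>z\<in>Z. snd z * s - fst z * t) * h s t"
  proof (rule insert.IH)
    show "(0, 0) \<notin> Z" using insert.prems(1) by blast
    show "(s, t) = (s', t')" if "(s, t) \<in> Z" "(s', t') \<in> Z" "t' * s = s' * t" for s t s' t'
      using insert.prems(2)[of s t s' t'] that by blast
    show "g1 s t = 0" if "(s, t) \<in> Z" for s t
    proof -
      have "(s, t) \<noteq> (s\<^sub>0, t\<^sub>0)" using insert.hyps(2) that z by blast
      then have "t\<^sub>0 * s - s\<^sub>0 * t \<noteq> 0" using insert.prems(2)[of s t s\<^sub>0 t\<^sub>0] that z by auto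
      then show ?thesis using eq[of s t] insert.prems(4)[of s t] that by simp
    qed
  qed (fact g1)
  then show ?case using eq insert.hyps by (auto simp: z mult.assoc)
qed

text \<open>The two forms define a map of the projective line to itself which, after cancelling the
  common factor, is linear; a linear map multiplies the bracket of two points by its
  determinant \<open>\<kappa>\<close>.\<close>

lemma bracket_of_forms_with_common_roots:
  assumes Z: "finite Z" "(0, 0) \<notin> Z"
      "\<And>s t s' t'. (s, t) \<in> Z \<Longrightarrow> (s', t') \<in> Z \<Longrightarrow> t' * s = s' * t \<Longrightarrow> (s, t) = (s', t')"
    and A: "A \<in> binary_forms (card Z + 1)" "\<And>s t. (s, t) \<in> Z \<Longrightarrow> A s t = 0"
    and B: "B \<in> binary_forms (card Z + 1)" "\<And>s t. (s, t) \<in> Z \<Longrightarrow> B s t = 0"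
  obtains \<kappa> g where "\<And>s t s' t'.
    A s t * B s' t' - A s' t' * B s t = \<kappa> * g s t * g s' t' * (s * t' - s' * t)"
proof -
  define g where "g s t = (\<Prod>z\<in>Z. snd z * s - fst z * t)" for s t
  obtain L where L: "L \<in> binary_forms 1" and AL: "\<And>s t. A s t = g s t * L s t"
    using binary_form_factor_set[OF Z A] unfolding g_def by blast
  obtain M where M: "M \<in> binary_forms 1" and BM: "\<And>s t. B s t = g s t * M s t"
    using binary_form_factor_set[OF Z B] unfolding g_def by blast
  obtain c where c: "L = (\<lambda>s t. \<Sum>k\<le>1. c k * s ^ k * t ^ (1 - k))"
    by (rule binary_formsE[OF L])
  obtain d where d: "M = (\<lambda>s t. \<Sum>k\<le>1. d k * s ^ k * t ^ (1 - k))"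
    by (rule binary_formsE[OF M])
  show thesis
  proof
    show "A s t * B s' t' - A s' t' * B s t =
        (c (Suc 0) * d 0 - c 0 * d (Suc 0)) * g s t * g s' t' * (s * t' - s' * t)" for s t s' t'
      unfolding AL BM c d by (simp add: algebra_simps)
  qed
qed

section \<open>Brackets of points under projection from a secant subspace\<close>

text \<open>For \<open>q\<close> the Pluecker coordinates of the equations \<open>a, b\<close> this is the determinant
  \<open>a(x) b(y) - a(y) b(x)\<close>: the bracket of the images of the points \<open>x\<close> and \<open>y\<close> under the projection
  from \<open>{a = b = 0}\<close> to the line.\<close>

definition bracket :: "('n::finite \<Rightarrow> 'n \<Rightarrow> complex) \<Rightarrow> complex ^ 'n \<Rightarrow> complex ^ 'n \<Rightarrow> complex" where
  "bracket q x y = (\<Sum>a\<in>UNIV. \<Sum>b\<in>UNIV. q a b * (x $ a * y $ b))"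

lemma bracket_pluecker:
  "bracket (pluecker a b) x y =
    (\<Sum>i\<in>UNIV. a $ i * x $ i) * (\<Sum>i\<in>UNIV. b $ i * y $ i) -
    (\<Sum>i\<in>UNIV. a $ i * y $ i) * (\<Sum>i\<in>UNIV. b $ i * x $ i)"
proof -
  have swap: "(\<Sum>i\<in>UNIV. a $ i * y $ i) * (\<Sum>i\<in>UNIV. b $ i * x $ i) =
      (\<Sum>i\<in>UNIV. b $ i * x $ i) * (\<Sum>i\<in>UNIV. a $ i * y $ i)"
    by (rule mult.commute)
  show ?thesis
    unfolding bracket_def pluecker_def swap
    unfolding sum_product by (simp add: algebra_simps flip: sum_subtractf)
qed

lemma bracket_scale:
  "bracket (\<lambda>a b. r * q a b) (c *s x) (d *s y) = r * c * d * bracket q x y"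
  by (simp add: bracket_def sum_distrib_left algebra_simps)

text \<open>Distinct points of the curve have non-proportional parameters, so the \<open>n - 1\<close> points on the
  subspace provide \<open>n - 1\<close> common roots of the pulled back equations, one less
  than their degree.\<close>

lemma bracket_secant:
  fixes f :: "'n::finite \<Rightarrow> complex \<Rightarrow> complex \<Rightarrow> complex"
  assumes f: "\<And>i. f i \<in> binary_forms n" and n: "n \<ge> 1"
    and C: "C = {vec.span {\<chi> i. f i s t} | s t. (s, t) \<noteq> (0, 0)}"
    and sec: "secant (n - 1) (linear_locus a b) C"
  obtains \<kappa> g where "\<And>s t s' t'.
    bracket (pluecker a b) (\<chi> i. f i s t) (\<chi> i. f i s' t') =
      \<kappa> * g s t * g s' t' * (s * t' - s' * t)"
proof -
  define \<phi> where "\<phi> z = (\<chi> i. f i (fst z) (snd z))" for z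
  define S where "S = {P \<in> C. P \<subseteq> linear_locus a b}"
  have "\<forall>P\<in>S. \<exists>z. z \<noteq> (0, 0) \<and> P = vec.span {\<phi> z}"
    unfolding S_def C \<phi>_def by fastforce
  then obtain \<zeta> where \<zeta>: "\<And>P. P \<in> S \<Longrightarrow> \<zeta> P \<noteq> (0, 0)" "\<And>P. P \<in> S \<Longrightarrow> P = vec.span {\<phi> (\<zeta> P)}"
    by metis
  define Z where "Z = \<zeta> ` S"
  have "inj_on \<zeta> S" by (rule inj_onI) (metis \<zeta>(2))
  moreover have S: "finite S" "card S = n - 1" using sec unfolding secant_def S_def by auto
  ultimately have cardZ: "card Z + 1 = n" unfolding Z_def using n by (simp add: card_image)
  have finZ: "finite Z" unfolding Z_def using S by simp
  have zeroZ: "(0, 0) \<notin> Z" unfolding Z_def using \<zeta>(1) by force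
  have distinct: "(s, t) = (s', t')"
    if st: "(s, t) \<in> Z" and st': "(s', t') \<in> Z" and cross: "t' * s = s' * t" for s t s' t'
  proof -
    obtain P P' where P: "P \<in> S" "(s, t) = \<zeta> P" and P': "P' \<in> S" "(s', t') = \<zeta> P'"
      using st st' unfolding Z_def by blast
    have nz: "(s, t) \<noteq> (0, 0)" "(s', t') \<noteq> (0, 0)" using st st' zeroZ by auto
    obtain r where r: "r \<noteq> 0" "s' = r * s" "t' = r * t"
    proof (cases "s = 0")
      case True
      then have "t \<noteq> 0" "s' = 0" "t' \<noteq> 0" using nz cross by auto
      then show ?thesis using that[of "t' / t"] True by simp
    next
      case False
      then have "s' \<noteq> 0" using cross nz(2) by auto
      with False show ?thesis using that[of "s' / s"] cross by (simp add: field_simps)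
    qed
    have "\<phi> (s', t') = r ^ n *s \<phi> (s, t)"
      by (simp add: \<phi>_def vec_eq_iff r binary_form_homogeneous[OF f])
    moreover have "vec.span {r ^ n *s \<phi> (s, t)} = vec.span {\<phi> (s, t)}"
      using vec.span_image_scale[of "{\<phi> (s, t)}" "\<lambda>_. r ^ n"] r(1) by simp
    ultimately have "P = P'" using \<zeta>(2) P P' by metis
    then show ?thesis using P P' by simp
  qed
  have form: "(\<lambda>s t. \<Sum>i\<in>UNIV. c $ i * f i s t) \<in> binary_forms (card Z + 1)" for c :: "complex ^ 'n"
    unfolding cardZ by (intro binary_forms_sum binary_forms_scale f) simp
  have root: "(\<Sum>i\<in>UNIV. a $ i * f i s t) = 0 \<and> (\<Sum>i\<in>UNIV. b $ i * f i s t) = 0"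
    if "(s, t) \<in> Z" for s t
  proof -
    obtain P where P: "P \<in> S" "(s, t) = \<zeta> P" using \<open>(s, t) \<in> Z\<close> unfolding Z_def by blast
    have "\<phi> (s, t) \<in> vec.span {\<phi> (s, t)}" by (simp add: vec.span_base)
    then have "\<phi> (s, t) \<in> linear_locus a b" using P \<zeta>(2) unfolding S_def by auto
    then show ?thesis by (simp add: linear_locus_def \<phi>_def)
  qed
  define A where "A s t = (\<Sum>i\<in>UNIV. a $ i * f i s t)" for s t
  define B where "B s t = (\<Sum>i\<in>UNIV. b $ i * f i s t)" for s t
  have AB_forms: "A \<in> binary_forms (card Z + 1)" "B \<in> binary_forms (card Z + 1)"
    unfolding A_def[abs_def] B_def[abs_def] by (rule form)+
  have AB_roots: "A s t = 0" "B s t = 0" if "(s, t) \<in> Z" for s t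
    using root[OF that] by (simp_all add: A_def B_def)
  obtain \<kappa> g where AB: "\<And>s t s' t'.
      A s t * B s' t' - A s' t' * B s t = \<kappa> * g s t * g s' t' * (s * t' - s' * t)"
    by (rule bracket_of_forms_with_common_roots[OF finZ zeroZ _ AB_forms(1) _ AB_forms(2)])
      (erule (2) distinct, erule AB_roots, erule AB_roots, rule that)
  show thesis
  proof
    show "bracket (pluecker a b) (\<chi> i. f i s t) (\<chi> i. f i s' t') =
        \<kappa> * g s t * g s' t' * (s * t' - s' * t)" for s t s' t'
      using AB[of s t s' t'] by (simp add: bracket_pluecker A_def B_def)
  qed
qed

section \<open>The condition of equal cross-ratios\<close>

text \<open>The cross-ratio of four points on the line is the quotient of
  \<open>[0 1] [2 3]\<close> by \<open>[0 2] [1 3]\<close>; this is the difference of the cross-ratios for two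
  projections, multiplied by both denominators.\<close>

definition cross_ratio_difference ::
  "(nat \<Rightarrow> 'n::finite \<Rightarrow> 'n \<Rightarrow> complex) \<Rightarrow> (nat \<Rightarrow> complex ^ 'n) \<Rightarrow> complex" where
  "cross_ratio_difference q x =
    bracket (q 0) (x 0) (x 1) * bracket (q 0) (x 2) (x 3) *
      (bracket (q 1) (x 0) (x 2) * bracket (q 1) (x 1) (x 3)) -
    bracket (q 0) (x 0) (x 2) * bracket (q 0) (x 1) (x 3) *
      (bracket (q 1) (x 0) (x 1) * bracket (q 1) (x 2) (x 3))"

lemma polynomial_fun_sum:
  assumes "finite I" "\<And>i. i \<in> I \<Longrightarrow> polynomial_fun l p (f i)"
  shows "polynomial_fun l p (\<lambda>q x. \<Sum>i\<in>I. f i q x)"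
  using assms
proof (induction I rule: finite_induct)
  case empty
  show ?case using polynomial_fun.const[of l p 0] by simp
next
  case (insert i I)
  then show ?case
    using polynomial_fun.add[of l p "f i" "\<lambda>q x. \<Sum>i\<in>I. f i q x"] by simp
qed

lemma polynomial_fun_diff:
  assumes "polynomial_fun l p f" "polynomial_fun l p g"
  shows "polynomial_fun l p (\<lambda>q x. f q x - g q x)"
  using polynomial_fun.add[OF assms(1)
      polynomial_fun.mult[OF polynomial_fun.const[of l p "- 1"] assms(2)]]
  by simp

lemma polynomial_fun_bracket:
  assumes "i < l" "j < p" "k < p"
  shows "polynomial_fun l p (\<lambda>q x. bracket (q i) (x j) (x k))"
  unfolding bracket_def using assms
  by (intro polynomial_fun_sum polynomial_fun.mult polynomial_fun.subspace_coord
      polynomial_fun.point_coord) auto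

lemma polynomial_fun_cross_ratio_difference:
  assumes "l \<ge> 2" "p \<ge> 4"
  shows "polynomial_fun l p cross_ratio_difference"
proof -
  have "polynomial_fun l p (\<lambda>q x. cross_ratio_difference q x)"
    unfolding cross_ratio_difference_def using assms
    by (intro polynomial_fun_diff polynomial_fun.mult polynomial_fun_bracket) auto
  then show ?thesis .
qed

lemma prod_squares_initial_segment:
  fixes s :: "nat \<Rightarrow> complex"
  assumes "m \<le> l"
  shows "(\<Prod>i<l. s i ^ (if i < m then 2 else 0)) = (\<Prod>i<m. s i ^ 2)"
  by (rule prod.mono_neutral_cong_right) (use assms in auto)

text \<open>In each of the two products, both subspaces and all four points occur in exactly two
  brackets, so every degree is two.\<close>

lemma multihomogeneous_cross_ratio_difference:
  assumes "l \<ge> 2" "p \<ge> 4"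
  shows "multihomogeneous l p cross_ratio_difference"
proof -
  have "cross_ratio_difference (\<lambda>i a b. s i * q i a b) (\<lambda>j. t j *s x j) =
      (\<Prod>i<l. s i ^ (if i < 2 then 2 else 0)) * (\<Prod>j<p. t j ^ (if j < 4 then 2 else 0)) *
      cross_ratio_difference q x" for s t q and x :: "nat \<Rightarrow> complex ^ 'a"
    unfolding prod_squares_initial_segment[OF assms(1)] prod_squares_initial_segment[OF assms(2)]
    unfolding cross_ratio_difference_def bracket_scale
    by (simp add: numeral_eq_Suc algebra_simps)
  then show ?thesis unfolding multihomogeneous_def
    by (intro exI[of _ "\<lambda>i. if i < 2 then 2 else 0"] exI[of _ "\<lambda>j. if j < 4 then 2 else 0"]) blast
qed

text \<open>By \<open>bracket_secant\<close> both products equal a common factor times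
  \<open>(01) (23) (02) (13)\<close>, where \<open>(jk)\<close> is the bracket of the parameters of the points \<open>j\<close> and \<open>k\<close>.\<close>

lemma cross_ratio_difference_on_curve:
  fixes a b v :: "nat \<Rightarrow> complex ^ 'n::finite"
  assumes C: "rational_normal_curve n C" and n: "n \<ge> 1"
    and sec: "\<And>i. i < 2 \<Longrightarrow> secant (n - 1) (linear_locus (a i) (b i)) C"
    and pts: "\<And>j. j < 4 \<Longrightarrow> vec.span {v j} \<in> C"
  shows "cross_ratio_difference (\<lambda>i. pluecker (a i) (b i)) v = 0"
proof -
  obtain f :: "'n \<Rightarrow> complex \<Rightarrow> complex \<Rightarrow> complex"
    where f: "\<And>i. f i \<in> binary_forms n"
      and Ceq: "C = {vec.span {\<chi> i. f i s t} | s t. (s, t) \<noteq> (0, 0)}"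
    using C unfolding rational_normal_curve_def by blast
  obtain \<kappa>\<^sub>0 g\<^sub>0 where br0: "\<And>s t s' t'.
      bracket (pluecker (a 0) (b 0)) (\<chi> i. f i s t) (\<chi> i. f i s' t') =
      \<kappa>\<^sub>0 * g\<^sub>0 s t * g\<^sub>0 s' t' * (s * t' - s' * t)"
    by (rule bracket_secant[OF f n Ceq sec[of 0]]) auto
  obtain \<kappa>\<^sub>1 g\<^sub>1 where br1: "\<And>s t s' t'.
      bracket (pluecker (a 1) (b 1)) (\<chi> i. f i s t) (\<chi> i. f i s' t') =
      \<kappa>\<^sub>1 * g\<^sub>1 s t * g\<^sub>1 s' t' * (s * t' - s' * t)"
    by (rule bracket_secant[OF f n Ceq sec[of 1]]) auto
  have "\<forall>j. \<exists>r s t. j < 4 \<longrightarrow> v j = r *s (\<chi> i. f i s t)"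
  proof
    fix j
    show "\<exists>r s t. j < 4 \<longrightarrow> v j = r *s (\<chi> i. f i s t)"
    proof (cases "j < 4")
      case True
      then obtain s t where "vec.span {v j} = vec.span {\<chi> i. f i s t}"
        using pts[OF True] unfolding Ceq by blast
      then have "v j \<in> vec.span {\<chi> i. f i s t}" using vec.span_base[of "v j" "{v j}"] by simp
      then show ?thesis by (auto simp: vec.span_singleton)
    qed simp
  qed
  then obtain r s t where v: "\<And>j. j < 4 \<Longrightarrow> v j = r j *s (\<chi> i. f i (s j) (t j))"
    by metis
  have scale: "bracket q (c *s x) (d *s y) = c * d * bracket q x y"
    for q :: "'n \<Rightarrow> 'n \<Rightarrow> complex" and c d x y
    using bracket_scale[of 1 q c x d y] by simp
  have v4: "v 0 = r 0 *s (\<chi> i. f i (s 0) (t 0))" "v 1 = r 1 *s (\<chi> i. f i (s 1) (t 1))"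
    "v 2 = r 2 *s (\<chi> i. f i (s 2) (t 2))" "v 3 = r 3 *s (\<chi> i. f i (s 3) (t 3))"
    by (rule v; simp)+
  show ?thesis
    unfolding cross_ratio_difference_def v4 scale br0 br1 by (simp only: ac_simps diff_self)
qed

section \<open>A configuration with distinct cross-ratios\<close>

lemma linear_locus_axis: "linear_locus (axis i 1) (axis j 1) = {x. x $ i = 0 \<and> x $ j = 0}"
  by (simp add: linear_locus_def axis_def if_distrib[of "\<lambda>x. x * _"] cong: if_cong)

lemma linear_locus_axis_in_proj_subspaces:
  fixes i j :: "'n::finite"
  assumes "CARD('n) = n + 1" "n \<ge> 2" "i \<noteq> j"
  shows "linear_locus (axis i 1) (axis j 1) \<in> proj_subspaces (n - 2)"
proof -
  have eq: "linear_locus (axis i 1) (axis j 1) = {x :: complex ^ 'n. \<forall>k. k \<notin> - {i, j} \<longrightarrow> x $ k = 0}"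
    unfolding linear_locus_axis by auto
  have "card (- {i, j}) = n - 2 + 1"
    using assms by (simp add: Compl_eq_Diff_UNIV card_Diff_subset)
  then have "vec.dim (linear_locus (axis i 1) (axis j 1)) = n - 2 + 1"
    unfolding eq by (subst dim_substandard_cart) simp
  moreover have "vec.subspace (linear_locus (axis i 1 :: complex ^ 'n) (axis j 1))"
    unfolding linear_locus_axis by (rule vec.subspaceI) auto
  ultimately show ?thesis unfolding proj_subspaces_def by simp
qed

lemma span_in_proj_points: "v \<noteq> 0 \<Longrightarrow> vec.span {v} \<in> proj_points"
  unfolding proj_points_def proj_subspaces_def
  using vec.dim_eq_card_independent[of "{v}"] by (simp add: vec.dim_span)

text \<open>For distinct indices \<open>i\<^sub>0, i\<^sub>1, i\<^sub>2, i\<^sub>3\<close> take \<open>\<Lambda>\<^sub>0 = {x\<^bsub>i\<^sub>0\<^esub> = x\<^bsub>i\<^sub>1\<^esub> = 0}\<close> and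
  \<open>\<Lambda>\<^sub>1 = {x\<^bsub>i\<^sub>2\<^esub> = x\<^bsub>i\<^sub>3\<^esub> = 0}\<close>. The four points are chosen so that they pair up
  as \<open>02|13\<close> under the first projection and as \<open>01|23\<close> under the second one, which makes the
  first product in the difference \<open>1\<close> and the second \<open>0\<close>.\<close>

lemma cross_ratio_difference_not_identically_zero:
  assumes card: "CARD('n::finite) = n + 1" and n: "n \<ge> 3"
  obtains a b v :: "nat \<Rightarrow> complex ^ 'n"
  where "\<And>i. linear_locus (a i) (b i) \<in> proj_subspaces (n - 2)"
    and "\<And>j. vec.span {v j} \<in> proj_points"
    and "cross_ratio_difference (\<lambda>i. pluecker (a i) (b i)) v \<noteq> 0"
proof -
  have "4 \<le> card (UNIV :: 'n set)" using card n by simp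
  then obtain T :: "'n set" where "card T = 4" by (meson obtain_subset_with_card_n)
  then obtain i0 i1 i2 i3 :: 'n where dist: "distinct [i0, i1, i2, i3]"
    by (auto simp: card_Suc_eq numeral_eq_Suc)
  define a :: "nat \<Rightarrow> complex ^ 'n" where "a i = axis (if i = 0 then i0 else i2) 1" for i
  define b :: "nat \<Rightarrow> complex ^ 'n" where "b i = axis (if i = 0 then i1 else i3) 1" for i
  define v :: "nat \<Rightarrow> complex ^ 'n" where
    "v j = axis (if j = 0 \<or> j = 2 then i0 else i1) 1 + axis (if j = 0 \<or> j = 1 then i2 else i3) 1" for j
  show thesis
  proof
    show "linear_locus (a i) (b i) \<in> proj_subspaces (n - 2)" for i
      unfolding a_def b_def
      by (rule linear_locus_axis_in_proj_subspaces[OF card]) (use dist n in auto)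
    have "v j $ (if j = 0 \<or> j = 2 then i0 else i1) \<noteq> 0" for j
      using dist by (auto simp: v_def axis_def)
    then have "v j \<noteq> 0" for j by (metis zero_index)
    then show "vec.span {v j} \<in> proj_points" for j by (rule span_in_proj_points)
    have coord: "(\<Sum>k\<in>UNIV. axis i 1 $ k * x $ k) = x $ i" for i and x :: "complex ^ 'n"
      by (simp add: axis_def if_distrib[of "\<lambda>x. x * _"] cong: if_cong)
    have "cross_ratio_difference (\<lambda>i. pluecker (a i) (b i)) v = 1"
      unfolding cross_ratio_difference_def bracket_pluecker a_def b_def coord
      using dist by (auto simp: v_def axis_def)
    then show "cross_ratio_difference (\<lambda>i. pluecker (a i) (b i)) v \<noteq> 0" by simp
  qed
qed

section \<open>Non-existence of the curve\<close>

theorem proposition4p3: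
  fixes n p l :: nat
  assumes "CARD('n::finite) = n + 1" and "n \<ge> 3" and "p \<ge> 4" and "l \<ge> 2"
  shows "\<exists>U :: ((nat \<Rightarrow> (complex ^ 'n) set) \<times> (nat \<Rightarrow> (complex ^ 'n) set)) set.
           zariski_open n l p U \<and> U \<noteq> {} \<and>
           (\<forall>(\<Lambda>, P) \<in> U.
              \<not> (\<exists>C. rational_normal_curve n C \<and>
                     (\<forall>j<p. P j \<in> C) \<and> (\<forall>i<l. secant (n - 1) (\<Lambda> i) C)))"
proof -
  let ?D = "data_space n l p :: ((nat \<Rightarrow> (complex ^ 'n) set) \<times> (nat \<Rightarrow> (complex ^ 'n) set)) set"
  define U where "U = {(\<Lambda>, P) \<in> ?D. \<not> vanishes_at l p cross_ratio_difference \<Lambda> P}"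
  have "?D - U = {(\<Lambda>, P) \<in> ?D. \<forall>f\<in>{cross_ratio_difference}. vanishes_at l p f \<Lambda> P}"
    unfolding U_def by auto
  then have "zariski_closed n l p (?D - U)"
    unfolding zariski_closed_def
    using polynomial_fun_cross_ratio_difference[OF assms(4,3)]
      multihomogeneous_cross_ratio_difference[OF assms(4,3)]
    by (intro exI[of _ "{cross_ratio_difference}"]) blast
  then have "zariski_open n l p U" unfolding zariski_open_def U_def by auto
  moreover have "U \<noteq> {}"
  proof -
    obtain a b v :: "nat \<Rightarrow> complex ^ 'n"
      where abv: "\<And>i. linear_locus (a i) (b i) \<in> proj_subspaces (n - 2)"
        "\<And>j. vec.span {v j} \<in> proj_points"
        and nz: "cross_ratio_difference (\<lambda>i. pluecker (a i) (b i)) v \<noteq> 0"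
      using cross_ratio_difference_not_identically_zero[OF assms(1,2)] by blast
    define \<Lambda> where "\<Lambda> = restrict (\<lambda>i. linear_locus (a i) (b i)) {..<l}"
    define P where "P = restrict (\<lambda>j. vec.span {v j}) {..<p}"
    have "(\<Lambda>, P) \<in> ?D" unfolding data_space_def \<Lambda>_def P_def using abv by auto
    moreover have "\<not> vanishes_at l p cross_ratio_difference \<Lambda> P"
      unfolding vanishes_at_def \<Lambda>_def P_def using nz by auto
    ultimately show ?thesis unfolding U_def by blast
  qed
  moreover have "\<not> (rational_normal_curve n C \<and>
      (\<forall>j<p. P j \<in> C) \<and> (\<forall>i<l. secant (n - 1) (\<Lambda> i) C))" if "(\<Lambda>, P) \<in> U" for \<Lambda> P C
  proof
    assume asm: "rational_normal_curve n C \<and>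
      (\<forall>j<p. P j \<in> C) \<and> (\<forall>i<l. secant (n - 1) (\<Lambda> i) C)"
    from that obtain a b v where eq: "\<And>i. i < l \<Longrightarrow> \<Lambda> i = linear_locus (a i) (b i)"
      "\<And>j. j < p \<Longrightarrow> P j = vec.span {v j}"
      and nz: "cross_ratio_difference (\<lambda>i. pluecker (a i) (b i)) v \<noteq> 0"
      unfolding U_def vanishes_at_def by auto
    have "secant (n - 1) (linear_locus (a i) (b i)) C" if "i < 2" for i
    proof -
      have "i < l" using that assms(4) by simp
      then show ?thesis using asm eq(1)[of i] by metis
    qed
    moreover have "vec.span {v j} \<in> C" if "j < 4" for j
    proof -
      have "j < p" using that assms(3) by simp
      then show ?thesis using asm eq(2)[of j] by metis
    qed
    ultimately show False
      using cross_ratio_difference_on_curve[of n C a b v] asm nz assms(2) by auto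
  qed
  ultimately show ?thesis by (intro exI[of _ U]) blast
qed

end
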